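(* Let $\widetilde{EF}(N)$ be the number of edges of the tilde-Fibonacci cube with $N$ vertices (defined for $N=f_{n+2}=|V(\tilde F_n)|$, $n\ge 1$, by $\widetilde{EF}(f_{n+2})=|E(\tilde F_n)|$), and let $\widetilde{EQ}(N)=N(3\log_2 N-1)/4$ be the number of edges of the tilde-hypercube with $N$ vertices. Then their ratio is asymptotically bounded by $$0.85<\frac{\widetilde{EF}(N)}{\widetilde{EQ}(N)}<0.86,$$ i.e. these inequalities hold with $N=f_{n+2}$ for all sufficiently large $n$.
   Context: Fibonacci numbers: $f_1=f_2=1$, $f_i=f_{i-1}+f_{i-2}$ for $i\ge3$. For binary words $u,v$ of equal length, the tilde-distance $\mathrm{dist}_\sim(u,v)$ is the minimum number of replacements (changing the symbol in one position to the opposite symbol) and swaps (exchanging two adjacent different symbols) needed to transform $u$ into $v$. The $n$-tilde-hypercube $\tilde Q_n$ is the (simple, undirected) graph whose vertices are the $2^n$ binary words of length $n$, two vertices being adjacent exactly when their tilde-distance is $1$. The tilde-Fibonacci cube $\tilde F_n$ of order $n\ge1$ is the subgraph of $\tilde Q_n$ obtained by removing all vertices that contain $11$ as a factor (contiguous subword), i.e. the subgraph induced on the words avoiding $11$; it has $f_{n+2}$ vertices. The number of edges of $\tilde Q_n$, expressed through its number of vertices $N=2^n$, is $\widetilde{EQ}(N)=N(3\log_2 N-1)/4$; by convention this formula is used as the definition of $\widetilde{EQ}(N)$ also for values $N$ that are not powers of $2$. $V(G)$ and $E(G)$ denote the vertex set and edge set of a graph $G$. *)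

theory Defs
  imports Complex_Main "HOL-Library.Sublist" "HOL-Number_Theory.Fib"
begin

type_synonym word = "bool list"

inductive tilde_step :: "word \<Rightarrow> word \<Rightarrow> bool" where
  replacement: "tilde_step (xs @ a # ys) (xs @ (\<not> a) # ys)"
| swap: "a \<noteq> b \<Longrightarrow> tilde_step (xs @ a # b # ys) (xs @ b # a # ys)"

text \<open>Only meaningful for words of equal length: otherwise no number of operations
  transforms one word into the other.\<close>

definition tilde_dist :: "word \<Rightarrow> word \<Rightarrow> nat" where
  "tilde_dist u v = (LEAST k. (tilde_step ^^ k) u v)"

text \<open>Simple undirected graphs as a vertex set together with a set of two-element sets
  of vertices.\<close>

type_synonym 'a ugraph = "'a set \<times> 'a set set"

abbreviation verts :: "'a ugraph \<Rightarrow> 'a set" where "verts G \<equiv> fst G"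
abbreviation edges :: "'a ugraph \<Rightarrow> 'a set set" where "edges G \<equiv> snd G"

definition induced_subgraph :: "'a ugraph \<Rightarrow> 'a set \<Rightarrow> 'a ugraph" where
  "induced_subgraph G S = (verts G \<inter> S, {e \<in> edges G. e \<subseteq> S})"

definition tilde_hypercube :: "nat \<Rightarrow> word ugraph" where
  "tilde_hypercube n =
    ({w. length w = n},
     {{u, v} | u v. length u = n \<and> length v = n \<and> tilde_dist u v = 1})"

text \<open>The library relation \<open>sublist\<close> is the contiguous one, i.e. the factor relation.\<close>

definition tilde_fib_cube :: "nat \<Rightarrow> word ugraph" where
  "tilde_fib_cube n = induced_subgraph (tilde_hypercube n) {w. \<not> sublist [True, True] w}"

text \<open>\<open>EF N\<close> is the number of edges of the unique tilde-Fibonacci cube of positive order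
  with \<open>N\<close> vertices; it is meaningful only if such a cube exists.\<close>

definition EF :: "nat \<Rightarrow> nat" where
  "EF N = card (edges (tilde_fib_cube
      (THE n. n \<ge> 1 \<and> card (verts (tilde_fib_cube n)) = N)))"

text \<open>For \<open>N = 2 ^ n\<close> this is the number of edges of the tilde-hypercube with \<open>N\<close> vertices;
  for other \<open>N\<close> the formula itself is the definition.\<close>

definition EQ :: "real \<Rightarrow> real" where
  "EQ N = N * (3 * log 2 N - 1) / 4"

end

(* Orient each edge of the cube so that a 0 becomes a 1 or a factor 01 becomes 10. Splitting the
   edges according to the first letters of their ends gives E(n+2) = E(n+1) + E(n) + f(n+3),
   hence 5 E(n) = n (f(n+1) + f(n+3)) + f(n). As f(n+1) + f(n+3) ~ sqrt 5 f(n+2) and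
   log f(n+2) ~ n log phi, the ratio tends to 4 / (3 sqrt 5 log_2 phi) = 0.8589..., and the
   rational bounds 34/49 < log_2 phi < 7/10 suffice to locate this limit. *)
theory Submission
  imports Defs
begin

subsection \<open>Edges of the tilde-Fibonacci cube\<close>

text \<open>The first clause covers both operations at the first differing letter: a replacement, or
  the swap of 01 into 10. Recursion from the left matches the recursion used for counting.\<close>

fun tilde_up :: "word \<Rightarrow> word \<Rightarrow> bool" where
  "tilde_up (False # x) (True # y) \<longleftrightarrow> x = y \<or> (\<exists>z. x = True # z \<and> y = False # z)"
| "tilde_up (True # x) (False # y) \<longleftrightarrow> False"
| "tilde_up (a # x) (b # y) \<longleftrightarrow> tilde_up x y"
| "tilde_up _ _ \<longleftrightarrow> False"

lemma tilde_up_Cons_same [simp]: "tilde_up (a # x) (a # y) \<longleftrightarrow> tilde_up x y"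
  by (cases a) auto

lemma tilde_up_append_same [simp]: "tilde_up (xs @ x) (xs @ y) \<longleftrightarrow> tilde_up x y"
  by (induction xs) auto

lemma tilde_up_irrefl: "\<not> tilde_up u u"
  by (induction u) auto

text \<open>At the first difference the lower word has \<open>False\<close>, so
  \<open>tilde_up\<close> is contained in a lexicographic order.\<close>

lemma tilde_up_asym: "tilde_up u v \<Longrightarrow> \<not> tilde_up v u"
  by (induction u v rule: tilde_up.induct) auto

lemma tilde_step_Cons: "tilde_step u v \<Longrightarrow> tilde_step (a # u) (a # v)"
  by (induction rule: tilde_step.induct) (metis append_Cons tilde_step.intros)+

lemma tilde_step_sym: "tilde_step u v \<Longrightarrow> tilde_step v u"
proof (induction rule: tilde_step.induct)
  case (replacement xs a ys)
  show ?case using tilde_step.replacement[of xs "\<not> a" ys] by simp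
next
  case (swap a b xs ys)
  then show ?case using tilde_step.swap[of b a xs ys] by simp
qed

lemma tilde_up_imp_step: "tilde_up u v \<Longrightarrow> tilde_step u v"
proof (induction u v rule: tilde_up.induct)
  case (1 x y)
  then show ?case
    using tilde_step.replacement[of "[]" False x] tilde_step.swap[of False True "[]"] by auto
qed (auto intro: tilde_step_Cons)

lemma tilde_step_iff_up: "tilde_step u v \<longleftrightarrow> tilde_up u v \<or> tilde_up v u"
proof
  assume "tilde_step u v"
  then show "tilde_up u v \<or> tilde_up v u"
  proof (induction rule: tilde_step.induct)
    case (replacement xs a ys)
    show ?case by (cases a) auto
  next
    case (swap a b xs ys)
    then show ?case by (cases a; cases b) auto
  qed
qed (auto intro: tilde_up_imp_step tilde_step_sym)

lemma tilde_steps_Cons: "(tilde_step ^^ k) u v \<Longrightarrow> (tilde_step ^^ k) (a # u) (a # v)"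
  by (induction k arbitrary: v) (auto intro: tilde_step_Cons)

text \<open>Replacements alone suffice, tail first and head last. Hence the \<open>LEAST\<close> in
  \<open>tilde_dist\<close> ranges over a nonempty set.\<close>

lemma tilde_steps_exist:
  assumes "length u = length v"
  shows "\<exists>k. (tilde_step ^^ k) u v"
  using assms
proof (induction u v rule: list_induct2)
  case Nil
  show ?case by (rule exI[of _ 0]) simp
next
  case (Cons a u b v)
  then obtain k where "(tilde_step ^^ k) u v" by blast
  then have k: "(tilde_step ^^ k) (a # u) (a # v)" by (rule tilde_steps_Cons)
  show ?case
  proof (cases "a = b")
    case False
    then have "tilde_step (a # v) (b # v)"
      using tilde_step.replacement[of "[]" a v] by (cases a; cases b) auto
    with k have "(tilde_step ^^ Suc k) (a # u) (b # v)" by auto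
    then show ?thesis by blast
  qed (use k in auto)
qed

lemma tilde_dist_eq_1_iff:
  assumes "length u = length v"
  shows "tilde_dist u v = 1 \<longleftrightarrow> tilde_step u v"
proof
  obtain k where "(tilde_step ^^ k) u v" using tilde_steps_exist[OF assms] by blast
  then have "(tilde_step ^^ tilde_dist u v) u v" unfolding tilde_dist_def by (rule LeastI)
  moreover assume "tilde_dist u v = 1"
  ultimately show "tilde_step u v" by (simp add: eq_OO)
next
  assume st: "tilde_step u v"
  then have "u \<noteq> v" using tilde_step_iff_up tilde_up_irrefl by blast
  show "tilde_dist u v = 1"
    unfolding tilde_dist_def
  proof (rule Least_equality)
    show "(tilde_step ^^ 1) u v" using st by (simp add: eq_OO)
    show "1 \<le> k" if "(tilde_step ^^ k) u v" for k
      using that \<open>u \<noteq> v\<close> by (cases k) auto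
  qed
qed

section \<open>Oriented edges between words avoiding 11\<close>

definition fib_words :: "nat \<Rightarrow> word set" where
  "fib_words n = {w. length w = n \<and> \<not> sublist [True, True] w}"

definition fib_up_pairs :: "nat \<Rightarrow> (word \<times> word) set" where
  "fib_up_pairs n = {(u, v). u \<in> fib_words n \<and> v \<in> fib_words n \<and> tilde_up u v}"

lemma verts_tilde_fib_cube: "verts (tilde_fib_cube n) = fib_words n"
  by (auto simp: tilde_fib_cube_def induced_subgraph_def tilde_hypercube_def fib_words_def)

lemma edges_tilde_fib_cube:
  "edges (tilde_fib_cube n) = (\<lambda>(u, v). {u, v}) ` fib_up_pairs n"
proof -
  have "edges (tilde_fib_cube n) =
      {{u, v} | u v. u \<in> fib_words n \<and> v \<in> fib_words n \<and> tilde_dist u v = 1}"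
    by (auto simp: tilde_fib_cube_def induced_subgraph_def tilde_hypercube_def fib_words_def)
  also have "\<dots> = {{u, v} | u v. u \<in> fib_words n \<and> v \<in> fib_words n \<and>
      (tilde_up u v \<or> tilde_up v u)}"
  proof -
    have "tilde_dist u v = 1 \<longleftrightarrow> tilde_up u v \<or> tilde_up v u"
      if "u \<in> fib_words n" "v \<in> fib_words n" for u v
      using that by (simp only: fib_words_def mem_Collect_eq tilde_dist_eq_1_iff tilde_step_iff_up)
    then show ?thesis by (simp cong: conj_cong)
  qed
  also have "\<dots> = (\<lambda>(u, v). {u, v}) ` fib_up_pairs n"
  proof (intro equalityI subsetI)
    fix e assume "e \<in> {{u, v} | u v. u \<in> fib_words n \<and> v \<in> fib_words n \<and>
      (tilde_up u v \<or> tilde_up v u)}"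
    then obtain u v where e: "e = {u, v}"
      and "(u, v) \<in> fib_up_pairs n \<or> (v, u) \<in> fib_up_pairs n"
      by (auto simp: fib_up_pairs_def)
    then show "e \<in> (\<lambda>(u, v). {u, v}) ` fib_up_pairs n"
      by (auto simp: insert_commute intro: rev_image_eqI)
  qed (auto simp: fib_up_pairs_def)
  finally show ?thesis .
qed

text \<open>By asymmetry each edge arises from exactly one oriented pair.\<close>

lemma card_edges_tilde_fib_cube: "card (edges (tilde_fib_cube n)) = card (fib_up_pairs n)"
proof -
  have "inj_on (\<lambda>(u, v). {u, v}) (fib_up_pairs n)"
    by (auto simp: inj_on_def fib_up_pairs_def doubleton_eq_iff dest: tilde_up_asym)
  then show ?thesis by (simp add: edges_tilde_fib_cube card_image)
qed

section \<open>Recursive counting of vertices and edges\<close>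

lemma sublist_TT_simps [simp]:
  "\<not> sublist [True, True] []"
  "sublist [True, True] (a # w) \<longleftrightarrow> sublist [True, True] w \<or> a \<and> (\<exists>z. w = True # z)"
  by (auto simp: sublist_Cons_right prefix_def Cons_eq_append_conv)

lemma fib_words_0: "fib_words 0 = {[]}"
  by (auto simp: fib_words_def)

lemma fib_words_1: "fib_words (Suc 0) = {[False], [True]}"
  by (auto simp: fib_words_def length_Suc_conv)

text \<open>An initial 1 must be followed by 0, which then imposes no condition on the rest.\<close>

lemma fib_words_Suc_Suc:
  "fib_words (Suc (Suc n)) = (#) False ` fib_words (Suc n) \<union> (\<lambda>w. True # False # w) ` fib_words n"
  by (auto simp: fib_words_def length_Suc_conv image_iff)

lemma finite_fib_words [simp]: "finite (fib_words n)"
  by (rule finite_subset[OF _ finite_lists_length_eq[of UNIV n]]) (auto simp: fib_words_def)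

lemma card_fib_words: "card (fib_words n) = fib (n + 2)"
proof (induction n rule: fib.induct)
  case (3 n)
  have "card (fib_words (Suc (Suc n))) = card (fib_words (Suc n)) + card (fib_words n)"
    unfolding fib_words_Suc_Suc
    by (subst card_Un_disjoint) (auto simp: card_image inj_on_def)
  with 3 show ?case by simp
qed (simp_all add: fib_words_0 fib_words_1)

lemma finite_fib_up_pairs [simp]: "finite (fib_up_pairs n)"
  by (rule finite_subset[of _ "fib_words n \<times> fib_words n"]) (auto simp: fib_up_pairs_def)

lemma fib_up_pairs_0: "fib_up_pairs 0 = {}"
  by (auto simp: fib_up_pairs_def fib_words_0)

lemma fib_up_pairs_1: "fib_up_pairs (Suc 0) = {([False], [True])}"
  by (auto simp: fib_up_pairs_def fib_words_1)

text \<open>A pair whose first letters differ is \<open>(0x, 10y)\<close> with \<open>y\<close> the tail of \<open>x\<close>: it is a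
  replacement if \<open>x\<close> starts with \<open>0\<close> and a swap if \<open>x\<close> starts with \<open>1\<close>.\<close>

lemma fib_up_pairs_Suc_Suc:
  "fib_up_pairs (Suc (Suc n)) =
     map_prod ((#) False) ((#) False) ` fib_up_pairs (Suc n) \<union>
     map_prod (\<lambda>w. True # False # w) (\<lambda>w. True # False # w) ` fib_up_pairs n \<union>
     (\<lambda>x. (False # x, True # False # tl x)) ` fib_words (Suc n)"
  (is "?L = ?A \<union> ?B \<union> ?C")
proof (intro equalityI subsetI)
  fix p assume "p \<in> ?L"
  then obtain u v where p: "p = (u, v)"
    and uv: "u \<in> fib_words (Suc (Suc n))" "v \<in> fib_words (Suc (Suc n))" "tilde_up u v"
    by (auto simp: fib_up_pairs_def)
  from uv show "p \<in> ?A \<union> ?B \<union> ?C"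
    unfolding p fib_words_Suc_Suc by (force simp: fib_up_pairs_def image_iff)
next
  fix p assume "p \<in> ?A \<union> ?B \<union> ?C"
  then show "p \<in> ?L"
    apply (auto simp: fib_up_pairs_def fib_words_Suc_Suc)
    apply (auto simp: fib_words_def length_Suc_conv image_iff)
    done
qed

text \<open>The first letters of the two ends separate the three families. In the third the lower
  word determines \<open>x\<close>, so it contributes \<open>card (fib_words (Suc n))\<close>, which
  is \<open>fib (n + 3)\<close>.\<close>

lemma card_fib_up_pairs_Suc_Suc:
  "card (fib_up_pairs (Suc (Suc n))) =
     card (fib_up_pairs (Suc n)) + card (fib_up_pairs n) + fib (n + 3)"
proof -
  have "card (fib_up_pairs (Suc (Suc n))) =
      card (fib_up_pairs (Suc n)) + card (fib_up_pairs n) + card (fib_words (Suc n))"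
    unfolding fib_up_pairs_Suc_Suc
    by (subst card_Un_disjoint, force, force, force, subst card_Un_disjoint)
       (auto simp: card_image inj_on_def prod_eq_iff)
  then show ?thesis by (simp add: card_fib_words eval_nat_numeral)
qed

text \<open>The sum \<open>fib (n + 1) + fib (n + 3)\<close> is the Lucas number L(n+2). Both sides
  satisfy the same recursion because L(n+2) + L(n+4) = 5 f(n+3), the source of the factor 5.\<close>

lemma card_fib_up_pairs:
  "5 * card (fib_up_pairs n) = n * (fib (n + 1) + fib (n + 3)) + fib n"
proof (induction n rule: fib.induct)
  case (3 n)
  then show ?case
    by (simp add: card_fib_up_pairs_Suc_Suc eval_nat_numeral algebra_simps)
qed (simp_all add: fib_up_pairs_0 fib_up_pairs_1 eval_nat_numeral)

lemma EF_fib: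
  assumes "n \<ge> 1"
  shows "5 * EF (fib (n + 2)) = n * (fib (n + 1) + fib (n + 3)) + fib n"
proof -
  have "(THE m. m \<ge> 1 \<and> card (verts (tilde_fib_cube m)) = fib (n + 2)) = n"
  proof (rule the_equality)
    fix m assume m: "m \<ge> 1 \<and> card (verts (tilde_fib_cube m)) = fib (n + 2)"
    \<comment> \<open>The shift by 2 skips the repetition \<open>fib 1 = fib 2\<close>, so the
      number of vertices determines the order and \<open>THE\<close> has a unique witness.\<close>
    have "strict_mono (\<lambda>n. fib (n + 2))"
      by (simp add: strict_mono_Suc_iff fib_neq_0_nat)
    then show "m = n"
      using m by (auto simp: verts_tilde_fib_cube card_fib_words dest: strict_mono_eq[of _ m n])
  qed (use assms in \<open>simp add: verts_tilde_fib_cube card_fib_words\<close>)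
  then show ?thesis
    by (simp only: EF_def card_edges_tilde_fib_cube card_fib_up_pairs)
qed

subsection \<open>Asymptotics\<close>

definition golden :: real where "golden = (1 + sqrt 5) / 2"

lemma golden_gt_1: "golden > 1"
  by (simp add: golden_def)

lemma golden_sq: "golden ^ 2 = golden + 1"
  by (simp add: golden_def field_simps power2_eq_square)

text \<open>The left side is the limit of (f(n+3) + f(n+1)) / f(n+2).\<close>

lemma golden_plus_inverse: "golden + 1 / golden = sqrt 5"
proof -
  have "golden + 1 / golden = 2 * golden - 1"
    using golden_gt_1 golden_sq by (simp add: field_simps power2_eq_square)
  then show ?thesis by (simp only:) (simp add: golden_def field_simps)
qed

text \<open>Reduces high powers to linear expressions in \<open>golden\<close>, so that bounds on
  \<open>sqrt 5\<close> suffice to estimate the logarithm.\<close>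

lemma golden_power: "golden ^ Suc n = real (fib (Suc n)) * golden + real (fib n)"
proof (induction n)
  case (Suc n)
  have "golden ^ Suc (Suc n) = golden * (real (fib (Suc n)) * golden + real (fib n))"
    by (metis Suc power_Suc)
  also have "\<dots> = real (fib (Suc n)) * golden ^ 2 + real (fib n) * golden"
    by (simp add: algebra_simps power2_eq_square)
  also have "\<dots> = real (fib (Suc (Suc n))) * golden + real (fib (Suc n))"
    by (simp add: golden_sq algebra_simps)
  finally show ?case .
qed simp

lemma sqrt_5_bounds: "2.236 < sqrt 5" "sqrt 5 < 2.237"
proof -
  show "2.236 < sqrt 5" by (rule real_less_rsqrt) (simp add: power2_eq_square)
  show "sqrt 5 < 2.237" by (rule real_less_lsqrt) (simp_all add: power2_eq_square)
qed

text \<open>Equivalent to \<open>2 ^ 34 < golden ^ 49\<close> and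
  \<open>golden ^ 10 < 2 ^ 7\<close>. The lower bound has to be sharp: 0.86 requires
  \<open>log 2 golden\<close> to exceed about 0.6934, and its value is about 0.6942.\<close>

lemma log_golden_bounds: "34 / 49 < log 2 golden" "log 2 golden < 7 / 10"
proof -
  have fib: "fib 9 = 34" "fib 10 = 55" "fib 11 = 89" "fib 12 = 144"
    by (simp_all add: eval_nat_numeral)
  have g: "1.618 < golden"
    using sqrt_5_bounds by (simp add: golden_def)
  moreover have "golden ^ 12 = 144 * golden + 89"
    using golden_power[of 11] by (simp add: fib)
  ultimately have "321.9 < golden ^ 12"
    by simp
  \<comment> \<open>Since 49 = 12 * 4 + 1, the bounds on \<open>golden ^ 12\<close> and
    \<open>golden\<close> combine; \<open>321.9 ^ 4 * 1.618\<close> exceeds \<open>2 ^ 34\<close> by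
    about one percent.\<close>
  then have "321.9 ^ 4 \<le> (golden ^ 12) ^ 4"
    by (intro power_mono) auto
  then have "321.9 ^ 4 * 1.618 \<le> (golden ^ 12) ^ 4 * golden"
    using g by (intro mult_mono) auto
  also have "(golden ^ 12) ^ 4 * golden = golden ^ 49"
    by (simp flip: power_mult power_Suc2)
  finally have "2 ^ 34 < golden ^ 49"
    by (simp add: power_divide)
  then have "real 34 < log 2 (golden ^ 49)"
    by (intro less_log_of_power) auto
  then show "34 / 49 < log 2 golden"
    using golden_gt_1 by (simp add: log_nat_power)
  have "golden ^ 10 = 55 * golden + 34"
    using golden_power[of 9] by (simp add: fib)
  then have "golden ^ 10 < 2 ^ 7"
    using sqrt_5_bounds by (simp add: golden_def)
  then have "log 2 (golden ^ 10) < real 7"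
    using golden_gt_1 by (subst log_less_iff) (auto simp: powr_numeral)
  then show "log 2 golden < 7 / 10"
    using golden_gt_1 by (simp add: log_nat_power)
qed

section \<open>Limits of Fibonacci quotients and logarithms\<close>

text \<open>Numerator and denominator are asymptotic to powers of \<open>golden\<close> over
  \<open>sqrt 5\<close>, and \<open>golden ^ n\<close> cancels. A quotient of powers covers
  \<open>i < j\<close> with natural exponents.\<close>

lemma fib_ratio_tendsto:
  "(\<lambda>n. real (fib (n + i)) / real (fib (n + j))) \<longlonglongrightarrow> golden ^ i / golden ^ j"
proof -
  have lim: "(\<lambda>n. real (fib (n + k)) / (golden ^ (n + k) / sqrt 5)) \<longlonglongrightarrow> 1" for k
    using fib_asymptotics[folded golden_def] by (rule LIMSEQ_ignore_initial_segment)
  have "(\<lambda>n. (real (fib (n + i)) / (golden ^ (n + i) / sqrt 5)) /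
      (real (fib (n + j)) / (golden ^ (n + j) / sqrt 5)) * (golden ^ i / golden ^ j))
      \<longlonglongrightarrow> 1 / 1 * (golden ^ i / golden ^ j)"
    by (intro tendsto_intros lim) auto
  moreover have "(real (fib (n + i)) / (golden ^ (n + i) / sqrt 5)) /
      (real (fib (n + j)) / (golden ^ (n + j) / sqrt 5)) * (golden ^ i / golden ^ j) =
      real (fib (n + i)) / real (fib (n + j))" for n
    using golden_gt_1 by (simp add: power_add field_simps)
  ultimately show ?thesis by simp
qed

lemma log_fib_tendsto: "(\<lambda>n. log 2 (real (fib (n + 2))) / real n) \<longlonglongrightarrow> log 2 golden"
proof -
  define a where "a n = real (fib n) / (golden ^ n / sqrt 5)" for n
  have "(\<lambda>n. a (n + 2)) \<longlonglongrightarrow> 1"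
    unfolding a_def by (rule LIMSEQ_ignore_initial_segment[OF fib_asymptotics[folded golden_def]])
  then have "(\<lambda>n. log 2 (a (n + 2))) \<longlonglongrightarrow> log 2 1"
    by (rule tendsto_log[OF tendsto_const]) auto
  \<comment> \<open>The bracket is what remains of log f(n+2) once \<open>n * log 2 golden\<close>
    is split off; it converges, so dividing by \<open>n\<close> removes it.\<close>
  then have "(\<lambda>n. (log 2 (a (n + 2)) + 2 * log 2 golden - log 2 (sqrt 5)) * (1 / real n) + log 2 golden)
      \<longlonglongrightarrow> (log 2 1 + 2 * log 2 golden - log 2 (sqrt 5)) * 0 + log 2 golden"
    by (intro tendsto_add tendsto_diff tendsto_mult tendsto_const lim_1_over_n)
  moreover have "\<forall>\<^sub>F n in sequentially.
      (log 2 (a (n + 2)) + 2 * log 2 golden - log 2 (sqrt 5)) * (1 / real n) + log 2 golden =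
      log 2 (real (fib (n + 2))) / real n"
    \<comment> \<open>At \<open>n = 0\<close> the sides differ: division by 0 yields 0, leaving
      \<open>log 2 golden\<close> on the left and 0 on the right.\<close>
    using eventually_gt_at_top[of 0]
  proof eventually_elim
    case (elim n)
    have "real (fib (n + 2)) = a (n + 2) * (golden ^ (n + 2) / sqrt 5)" "a (n + 2) > 0"
      using golden_gt_1 fib_neq_0_nat[of "n + 2"] by (auto simp: a_def)
    then have "log 2 (real (fib (n + 2))) =
        log 2 (a (n + 2)) + ((real n + 2) * log 2 golden - log 2 (sqrt 5))"
      using golden_gt_1 by (simp add: log_mult log_divide log_nat_power del: fib.simps power_Suc)
    then show ?case
      using elim by (simp add: field_simps)
  qed
  ultimately show ?thesis
    by (auto intro: Lim_transform_eventually)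
qed


theorem corollary26:
  "\<forall>\<^sub>F n in sequentially.
     0.85 < real (EF (fib (n + 2))) / EQ (real (fib (n + 2))) \<and>
     real (EF (fib (n + 2))) / EQ (real (fib (n + 2))) < 0.86"
proof -
  let ?r = "\<lambda>n. real (EF (fib (n + 2))) / EQ (real (fib (n + 2)))"
  define q where "q i n = real (fib (n + i)) / real (fib (n + 2))" for i n
  define l where "l n = log 2 (real (fib (n + 2))) / real n" for n
  let ?L = "log 2 golden"
  have L: "34 / 49 < ?L" "?L < 7 / 10"
    by (fact log_golden_bounds)+
  have q: "q i \<longlonglongrightarrow> golden ^ i / golden ^ 2" for i
    unfolding q_def by (rule fib_ratio_tendsto)
  \<comment> \<open>This is the ratio with numerator and denominator divided by n f(n+2); 4/5 comes
    from the 5 in \<open>EF_fib\<close> and the 4 in \<open>EQ\<close>.\<close>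
  have "(\<lambda>n. 4 / 5 * (q 1 n + q 3 n + q 0 n * (1 / real n)) / (3 * l n - 1 / real n))
      \<longlonglongrightarrow> 4 / 5 * (golden ^ 1 / golden ^ 2 + golden ^ 3 / golden ^ 2 + golden ^ 0 / golden ^ 2 * 0)
        / (3 * ?L - 0)"
    by (intro tendsto_intros q lim_1_over_n log_fib_tendsto[folded l_def]) (use L in auto)
  also have "golden ^ 1 / golden ^ 2 + golden ^ 3 / golden ^ 2 = sqrt 5"
    using golden_gt_1 golden_plus_inverse by (simp add: power2_eq_square power3_eq_cube)
  finally have "(\<lambda>n. 4 / 5 * (q 1 n + q 3 n + q 0 n * (1 / real n)) / (3 * l n - 1 / real n))
      \<longlonglongrightarrow> 4 * sqrt 5 / (15 * ?L)"
    by simp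
  moreover have "\<forall>\<^sub>F n in sequentially.
      4 / 5 * (q 1 n + q 3 n + q 0 n * (1 / real n)) / (3 * l n - 1 / real n) = ?r n"
    \<comment> \<open>Both \<open>EF_fib\<close> and the division by \<open>n\<close> require
      \<open>n >= 1\<close>.\<close>
    using eventually_ge_at_top[of 1]
  proof eventually_elim
    case (elim n)
    define N where "N = real (fib (n + 2))"
    have pos: "N > 0" "real n > 0"
      using elim fib_neq_0_nat[of "n + 2"] by (auto simp: N_def)
    have "real (5 * EF (fib (n + 2))) = real (n * (fib (n + 1) + fib (n + 3)) + fib n)"
      by (simp only: EF_fib[OF elim])
    then have "real (EF (fib (n + 2))) =
        (real n * (real (fib (n + 1)) + real (fib (n + 3))) + real (fib n)) / 5"
      by (simp del: fib.simps)
    also have "\<dots> = real n * N * (q 1 n + q 3 n + q 0 n * (1 / real n)) / 5"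
    proof -
      have "real (fib (n + 1)) = N * q 1 n" "real (fib (n + 3)) = N * q 3 n" "real (fib n) = N * q 0 n"
        using pos by (simp_all add: q_def N_def del: fib.simps)
      then show ?thesis
        using pos by (simp only:) (simp add: algebra_simps)
    qed
    finally have EF: "real (EF (fib (n + 2))) = real n * N * (q 1 n + q 3 n + q 0 n * (1 / real n)) / 5" .
    have EQ: "EQ N = real n * N * (3 * l n - 1 / real n) / 4"
    proof -
      have "log 2 N = real n * l n"
        using pos unfolding l_def N_def by (simp del: fib.simps)
      then show ?thesis
        using pos by (simp add: EQ_def algebra_simps)
    qed
    show ?case
      using pos unfolding EF N_def[symmetric] EQ by simp
  qed
  ultimately have lim: "?r \<longlonglongrightarrow> 4 * sqrt 5 / (15 * ?L)"
    by (rule Lim_transform_eventually)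
  \<comment> \<open>The bounds give at worst 8.944 / 10.5 > 0.851 and 438.452 / 510 < 0.8598; strict
    inequalities pass from the limit to all large \<open>n\<close>.\<close>
  have "0.85 < 4 * sqrt 5 / (15 * ?L)" "4 * sqrt 5 / (15 * ?L) < 0.86"
    using L sqrt_5_bounds by (simp_all add: field_simps)
  with order_tendstoD[OF lim] show ?thesis
    by (intro eventually_conj) blast+
qed

end
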